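(* Let $G$ be a finite group and let $\vartheta,\psi: G\to\mathrm{M}(n,\mathbb{C})$ be two different but equivalent, unitary, irreducible matrix representations of $G$ of dimension $n$. For $a,b\in\{1,\ldots,n\}$ let $$r_{ab}=\sqrt{\frac{n}{|G|}}\left(\sum_{g\in G}\vartheta_{aa}(g)\,\psi_{bb}(g^{-1})\right)^{1/2}.$$ Then $$\sum_{b=1}^n r_{ab}^2=1\ \text{ for all } a=1,\ldots,n,\qquad \sum_{a=1}^n r_{ab}^2=1\ \text{ for all } b=1,\ldots,n,$$ so the matrix with entries $r_{ab}^2$ is doubly stochastic.
   Context: For a matrix representation $\vartheta$, $\vartheta_{ij}(g)$ denotes the $(i,j)$ entry of $\vartheta(g)$. Two representations $\vartheta,\psi$ of $G$ in dimension $n$ are equivalent if there exists $X\in\mathrm{GL}(n,\mathbb{C})$ with $X^{-1}\vartheta(g)X=\psi(g)$ for all $g\in G$. A matrix representation is unitary if every $\vartheta(g)$ is a unitary matrix. The sum under the root is a nonnegative real number, and $r_{ab}$ is defined using its nonnegative square root. A real square matrix is doubly stochastic if its entries are nonnegative and all its rows and columns sum to $1$. *)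

theory Defs
  imports "HOL-Analysis.Analysis" "HOL-Algebra.Coset"
begin

definition GL :: "(complex ^ 'n ^ 'n) monoid" where
  "GL = \<lparr>carrier = {A. invertible A}, mult = (**), one = mat 1\<rparr>"

definition matrix_rep :: "('g, 'm) monoid_scheme \<Rightarrow> ('g \<Rightarrow> complex ^ 'n ^ 'n) \<Rightarrow> bool" where
  "matrix_rep G \<theta> \<longleftrightarrow> \<theta> \<in> hom G GL"

definition conj_transpose :: "complex ^ 'n ^ 'm \<Rightarrow> complex ^ 'm ^ 'n" where
  "conj_transpose A = (\<chi> i j. cnj (A $ j $ i))"

definition unitary_matrix :: "complex ^ 'n ^ 'n \<Rightarrow> bool" where
  "unitary_matrix A \<longleftrightarrow>
     A ** conj_transpose A = mat 1 \<and> conj_transpose A ** A = mat 1"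

definition unitary_rep :: "('g, 'm) monoid_scheme \<Rightarrow> ('g \<Rightarrow> complex ^ 'n ^ 'n) \<Rightarrow> bool" where
  "unitary_rep G \<theta> \<longleftrightarrow> matrix_rep G \<theta> \<and> (\<forall>g\<in>carrier G. unitary_matrix (\<theta> g))"

(* vec.subspace is the notion of a complex-linear subspace (the plain constant
   subspace is real-linear).  The representation space is nonzero because
   the index type 'n is nonempty. *)
definition irreducible_rep :: "('g, 'm) monoid_scheme \<Rightarrow> ('g \<Rightarrow> complex ^ 'n ^ 'n) \<Rightarrow> bool" where
  "irreducible_rep G \<theta> \<longleftrightarrow> matrix_rep G \<theta> \<and>
     (\<forall>W :: (complex ^ 'n) set.
        vec.subspace W \<and> (\<forall>g\<in>carrier G. \<forall>w\<in>W. \<theta> g *v w \<in> W) \<longrightarrow> W = {0} \<or> W = UNIV)"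

definition equivalent_reps ::
  "('g, 'm) monoid_scheme \<Rightarrow> ('g \<Rightarrow> complex ^ 'n ^ 'n) \<Rightarrow> ('g \<Rightarrow> complex ^ 'n ^ 'n) \<Rightarrow> bool" where
  "equivalent_reps G \<theta> \<psi> \<longleftrightarrow>
     (\<exists>X. invertible X \<and> (\<forall>g\<in>carrier G. matrix_inv X ** \<theta> g ** X = \<psi> g))"

definition diag_sum ::
  "('g, 'm) monoid_scheme \<Rightarrow> ('g \<Rightarrow> complex ^ 'n ^ 'n) \<Rightarrow> ('g \<Rightarrow> complex ^ 'n ^ 'n) \<Rightarrow> 'n \<Rightarrow> 'n \<Rightarrow> complex"
  where
  "diag_sum G \<theta> \<psi> a b = (\<Sum>g\<in>carrier G. \<theta> g $ a $ a * \<psi> (inv\<^bsub>G\<^esub> g) $ b $ b)"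

(* Taking the real part is meaningful only when diag_sum is a nonnegative real;
   this is asserted together with the statements about the coefficients. *)
definition r_coeff ::
  "('g, 'm) monoid_scheme \<Rightarrow> ('g \<Rightarrow> complex ^ 'n ^ 'n) \<Rightarrow> ('g \<Rightarrow> complex ^ 'n ^ 'n) \<Rightarrow> 'n \<Rightarrow> 'n \<Rightarrow> real"
  where
  "r_coeff G \<theta> \<psi> a b =
     sqrt (real CARD('n) / real (order G)) * sqrt (Re (diag_sum G \<theta> \<psi> a b))"

definition doubly_stochastic :: "real ^ 'n ^ 'n \<Rightarrow> bool" where
  "doubly_stochastic M \<longleftrightarrow>
     (\<forall>i j. 0 \<le> M $ i $ j) \<and>
     (\<forall>i. (\<Sum>j\<in>UNIV. M $ i $ j) = 1) \<and>
     (\<forall>j. (\<Sum>i\<in>UNIV. M $ i $ j) = 1)"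

end

(* By Schur's lemma, averaging A to the sum of \<theta>(g) A \<theta>(g\<inverse>) over G gives
   the scalar matrix with entry |G| tr A / n. If \<psi> = X\<inverse> \<theta> X, applying this to the
   matrix A whose row a is row b of X\<inverse> and whose other rows vanish gives
   r_ab\<^sup>2 = (X\<inverse>)_ba X_ab, so row and column sums are diagonal entries of X X\<inverse> and X\<inverse> X.
   Unitarity makes X X* commute with \<theta>, hence scalar; thus X\<inverse> is a positive multiple
   of X* and r_ab\<^sup>2 is a positive multiple of |X_ab|\<^sup>2. *)

theory Submission
  imports Defs "HOL-Computational_Algebra.Fundamental_Theorem_Algebra"
begin

section \<open>Eigenvectors of complex matrices and Schur's lemma\<close>

lemma poly_det:
  fixes M :: "'a::comm_ring_1 poly ^ 'n ^ 'n"
  shows "poly (det M) z = det (\<chi> i j. poly (M $ i $ j) z)"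
  by (simp add: det_def poly_sum poly_prod poly_mult sign_def)

lemma det_mult_entries:
  fixes A :: "'a::comm_ring_1 ^ 'n ^ 'n"
  shows "det (\<chi> i j. c * A $ i $ j) = c ^ CARD('n) * det A"
  by (simp add: det_def prod.distrib sum_distrib_left algebra_simps)

text \<open>If $\det(A - zI)$ had no zero it would be a nonzero constant $c$, and then
  $\det(wA - I) = c w^n$ for $w \neq 0$, which contradicts continuity at $w = 0$.\<close>

lemma ex_det_diff_mat_eq_0:
  fixes A :: "complex ^ 'n ^ 'n"
  shows "\<exists>z. det (A - mat z) = 0"
proof (rule ccontr)
  assume nz: "\<nexists>z. det (A - mat z) = 0"
  \<comment> \<open>Over the polynomial ring, \<open>q\<close> is det(A - xI) and \<open>p\<close>
    is det(xA - I). Since \<open>p\<close> is a polynomial, it supplies the continuity at 0.\<close>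
  define q where "q = det (\<chi> i j. [:A $ i $ j:] - (if i = j then [:0, 1:] else 0))"
  define p where "p = det (\<chi> i j. [:0, A $ i $ j:] - (if i = j then 1 else 0))"
  have q: "poly q z = det (A - mat z)" for z
    unfolding q_def poly_det
    by (rule arg_cong[where f = det]) (simp add: vec_eq_iff mat_def)
  have p: "poly p w = det (\<chi> i j. w * A $ i $ j - mat 1 $ i $ j)" for w
    unfolding p_def poly_det
    by (rule arg_cong[where f = det]) (simp add: vec_eq_iff mat_def)
  have "constant (poly q)"
    using fundamental_theorem_of_algebra[of q] nz q by auto
  then obtain c where c: "\<And>z. det (A - mat z) = c"
    unfolding constant_def q by blast
  have pw: "poly p w = w ^ CARD('n) * c" if "w \<noteq> 0" for w
  proof -
    have "(\<chi> i j. w * A $ i $ j - mat 1 $ i $ j) = (\<chi> i j. w * (A - mat (1 / w)) $ i $ j)"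
      using that by (simp add: vec_eq_iff mat_def algebra_simps)
    then show ?thesis
      using det_mult_entries[of w "A - mat (1 / w)"] c by (simp add: p)
  qed
  have "((\<lambda>w. w ^ CARD('n) * c) \<longlongrightarrow> 0 ^ CARD('n) * c) (at 0)"
    by (intro tendsto_intros)
  \<comment> \<open>The exponent is positive because the index type is nonempty, so the limit is 0
    whatever \<open>c\<close> is.\<close>
  then have "((\<lambda>w. w ^ CARD('n) * c) \<longlongrightarrow> 0) (at 0)"
    by (simp add: power_0_left)
  moreover have "eventually (\<lambda>w. w ^ CARD('n) * c = poly p w) (at 0)"
    using pw by (auto simp: eventually_at_filter)
  ultimately have "(poly p \<longlongrightarrow> 0) (at 0)"
    by (rule Lim_transform_eventually)
  moreover have "(poly p \<longlongrightarrow> poly p 0) (at 0)"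
    using poly_isCont[of 0 p] by (simp add: isCont_def)
  ultimately have "poly p 0 = 0"
    using tendsto_unique trivial_limit_at by blast
  \<comment> \<open>At w = 0 the matrix is -I, whose determinant is a power of -1 and hence
    nonzero.\<close>
  moreover have "(\<chi> i j. 0 * A $ i $ j - mat 1 $ i $ j) = (\<chi> i j. -1 * (mat 1 :: complex ^ 'n ^ 'n) $ i $ j)"
    by (simp add: vec_eq_iff)
  ultimately show False
    by (simp only: p det_mult_entries det_I) simp
qed

lemma mat_mult_vector: "mat z *v v = z *s v"
  for v :: "'a::semiring_1 ^ 'n"
  by (simp add: vec_eq_iff matrix_vector_mult_def mat_def if_distrib[where f = "\<lambda>x. x * _"] cong: if_cong)

lemma ex_eigenvector:
  fixes A :: "complex ^ 'n ^ 'n"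
  shows "\<exists>z v. v \<noteq> 0 \<and> A *v v = z *s v"
proof -
  obtain z where "det (A - mat z) = 0"
    using ex_det_diff_mat_eq_0 by blast
  then have "\<not> invertible (A - mat z)"
    by (simp add: invertible_det_nz)
  then obtain v where "v \<noteq> 0" "(A - mat z) *v v = 0"
    using matrix_left_invertible_ker[of "A - mat z"] invertible_left_inverse by blast
  then show ?thesis
    by (metis eq_iff_diff_eq_0 mat_mult_vector matrix_vector_mult_diff_rdistrib)
qed

text \<open>An eigenspace of \<open>A\<close> is invariant under every matrix commuting with
  \<open>A\<close>, and it is nonzero, so irreducibility makes it the whole space.\<close>

lemma schur_lemma:
  assumes irr: "irreducible_rep G \<theta>"
    and comm: "\<And>g. g \<in> carrier G \<Longrightarrow> A ** \<theta> g = \<theta> g ** A"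
  obtains z where "A = mat z"
proof -
  obtain z v where v: "v \<noteq> 0" "A *v v = z *s v"
    using ex_eigenvector by blast
  define W where "W = {w. A *v w = z *s w}"
  have "vec.subspace W"
    by (auto simp: W_def vec.subspace_def matrix_vector_right_distrib vector_add_ldistrib
        vector_scalar_commute vector_smult_assoc mult.commute)
  moreover have "\<theta> g *v w \<in> W" if "g \<in> carrier G" "w \<in> W" for g w
  proof -
    have "A *v (\<theta> g *v w) = \<theta> g *v (A *v w)"
      using comm[OF that(1)] by (simp add: matrix_vector_mul_assoc)
    then show ?thesis
      using that(2) by (simp add: W_def vector_scalar_commute)
  qed
  ultimately have "W = {0} \<or> W = UNIV"
    using irr by (auto simp: irreducible_rep_def)
  then have W: "W = UNIV"
    using v by (auto simp: W_def)
  then have "A = mat z"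
    by (auto simp: W_def matrix_eq mat_mult_vector)
  then show thesis ..
qed

section \<open>Elementary properties of matrix representations\<close>

lemma matrix_rep_mult:
  assumes "matrix_rep G \<theta>" "g \<in> carrier G" "h \<in> carrier G"
  shows "\<theta> (g \<otimes>\<^bsub>G\<^esub> h) = \<theta> g ** \<theta> h"
  using assms by (auto simp: matrix_rep_def hom_def GL_def)

lemma matrix_rep_invertible:
  assumes "matrix_rep G \<theta>" "g \<in> carrier G"
  shows "invertible (\<theta> g)"
  using assms by (auto simp: matrix_rep_def hom_def GL_def)

lemma matrix_rep_one:
  assumes "group G" "matrix_rep G \<theta>"
  shows "\<theta> \<one>\<^bsub>G\<^esub> = mat 1"
proof -
  interpret group G by fact
  have "\<theta> \<one>\<^bsub>G\<^esub> ** \<theta> \<one>\<^bsub>G\<^esub> = \<theta> \<one>\<^bsub>G\<^esub>"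
    using matrix_rep_mult[OF assms(2), of "\<one>\<^bsub>G\<^esub>" "\<one>\<^bsub>G\<^esub>"] by simp
  moreover obtain B where "B ** \<theta> \<one>\<^bsub>G\<^esub> = mat 1"
    using matrix_rep_invertible[OF assms(2)] by (auto simp: invertible_def)
  ultimately show ?thesis
    by (metis matrix_mul_assoc matrix_mul_lid)
qed

lemma matrix_rep_inv:
  assumes "group G" "matrix_rep G \<theta>" "g \<in> carrier G"
  shows "\<theta> g ** \<theta> (inv\<^bsub>G\<^esub> g) = mat 1" "\<theta> (inv\<^bsub>G\<^esub> g) ** \<theta> g = mat 1"
proof -
  interpret group G by fact
  show "\<theta> g ** \<theta> (inv\<^bsub>G\<^esub> g) = mat 1" "\<theta> (inv\<^bsub>G\<^esub> g) ** \<theta> g = mat 1"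
    using assms matrix_rep_mult[OF assms(2)] matrix_rep_one[OF assms(1,2)]
    by (metis inv_closed r_inv, metis inv_closed l_inv)
qed

section \<open>Averaging over the group\<close>

lemma matrix_mul_sum_left: "A ** sum f S = (\<Sum>i\<in>S. A ** f i)"
  for A :: "'a::semiring_1 ^ 'n ^ 'm"
  by (induction S rule: infinite_finite_induct) (auto simp: matrix_add_ldistrib)

lemma matrix_add_rdistrib: "(A + B) ** C = A ** C + B ** C"
  for A B :: "'a::semiring_1 ^ 'n ^ 'm"
  by (simp add: vec_eq_iff matrix_matrix_mult_def distrib_right sum.distrib)

lemma matrix_mul_sum_right: "sum f S ** A = (\<Sum>i\<in>S. f i ** A)"
  for A :: "'a::semiring_1 ^ 'n ^ 'm"
  by (induction S rule: infinite_finite_induct) (auto simp: matrix_add_rdistrib)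

lemma trace_sum: "trace (sum f S) = (\<Sum>i\<in>S. trace (f i))"
  for f :: "'b \<Rightarrow> 'a::comm_semiring_1 ^ 'n ^ 'n"
  unfolding trace_def by (simp add: sum.swap[of _ S])

text \<open>Replacing g by hg permutes the summands, which makes the sum commute with
  \<open>\<theta> h\<close>; Schur's lemma then gives a scalar. Each summand has the trace of
  \<open>A\<close>, and this determines the scalar. For an infinite carrier both sides are 0 by
  convention.\<close>

lemma sum_conj_rep_eq_mat:
  fixes \<theta> :: "'g \<Rightarrow> complex ^ 'n ^ 'n"
  assumes "group G" and irr: "irreducible_rep G \<theta>"
  shows "(\<Sum>g\<in>carrier G. \<theta> g ** A ** \<theta> (inv\<^bsub>G\<^esub> g))
    = mat (of_nat (order G) * trace A / of_nat CARD('n))" (is "?T = _")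
proof -
  interpret group G by fact
  have rep: "matrix_rep G \<theta>"
    using irr by (simp add: irreducible_rep_def)
  have comm: "?T ** \<theta> h = \<theta> h ** ?T" if h: "h \<in> carrier G" for h
  proof -
    have "\<theta> h ** ?T = (\<Sum>g\<in>carrier G. \<theta> (h \<otimes>\<^bsub>G\<^esub> g) ** A ** \<theta> (inv\<^bsub>G\<^esub> (h \<otimes>\<^bsub>G\<^esub> g)) ** \<theta> h)"
      unfolding matrix_mul_sum_left
    proof (rule sum.cong)
      fix g assume g: "g \<in> carrier G"
      have "\<theta> (inv\<^bsub>G\<^esub> (h \<otimes>\<^bsub>G\<^esub> g)) ** \<theta> h = \<theta> (inv\<^bsub>G\<^esub> g)"
        using g h by (simp add: inv_mult_group matrix_rep_mult[OF rep] matrix_rep_inv[OF assms(1) rep]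
            flip: matrix_mul_assoc)
      then show "\<theta> h ** (\<theta> g ** A ** \<theta> (inv\<^bsub>G\<^esub> g))
          = \<theta> (h \<otimes>\<^bsub>G\<^esub> g) ** A ** \<theta> (inv\<^bsub>G\<^esub> (h \<otimes>\<^bsub>G\<^esub> g)) ** \<theta> h"
        using g h by (simp add: matrix_rep_mult[OF rep] flip: matrix_mul_assoc)
    qed simp
    also have "\<dots> = (\<Sum>g\<in>carrier G. \<theta> g ** A ** \<theta> (inv\<^bsub>G\<^esub> g) ** \<theta> h)"
    proof (rule sum.reindex_bij_betw)
      show "bij_betw ((\<otimes>\<^bsub>G\<^esub>) h) (carrier G) (carrier G)"
        using h inj_on_cmult surj_const_mult by (auto simp: bij_betw_def)
    qed
    finally show ?thesis
      by (simp add: matrix_mul_sum_right)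
  qed
  obtain z where z: "?T = mat z"
    by (rule schur_lemma[OF irr comm])
  have "trace (\<theta> g ** A ** \<theta> (inv\<^bsub>G\<^esub> g)) = trace A" if "g \<in> carrier G" for g
    using that by (subst trace_mul_sym) (simp add: matrix_mul_assoc matrix_rep_inv[OF assms(1) rep])
  then have "trace ?T = of_nat (order G) * trace A"
    by (simp add: trace_sum order_def)
  moreover have "trace ?T = of_nat CARD('n) * z"
    unfolding z by (simp add: trace_def mat_def)
  ultimately have "z = of_nat (order G) * trace A / of_nat CARD('n)"
    by (simp add: field_simps)
  then show ?thesis
    unfolding z by simp
qed

text \<open>Each product of two diagonal entries is rewritten as a single entry of a matrix product,
  so that the sum over the group becomes an average of conjugates, which is scalar.\<close>

lemma diag_sum_conj:
  fixes \<theta> \<psi> :: "'g \<Rightarrow> complex ^ 'n ^ 'n"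
  assumes "group G" "irreducible_rep G \<theta>"
    and \<psi>: "\<And>g. g \<in> carrier G \<Longrightarrow> \<psi> g = Y ** \<theta> g ** X"
  shows "diag_sum G \<theta> \<psi> a b = of_nat (order G) / of_nat CARD('n) * (Y $ b $ a * X $ a $ b)"
proof -
  interpret group G by fact
  define A :: "complex ^ 'n ^ 'n" where "A = (\<chi> p q. if p = a then Y $ b $ q else 0)"
  have row: "(B ** A) $ a $ q = B $ a $ a * Y $ b $ q" for B :: "complex ^ 'n ^ 'n" and q
    by (simp add: A_def matrix_matrix_mult_def if_distrib[where f = "\<lambda>x. _ * x"] cong: if_cong)
  \<comment> \<open>Applied with \<open>B\<close> as \<open>\<theta> g\<close> and \<open>C\<close>
    as the image of the inverse of g under \<open>\<theta>\<close>, times \<open>X\<close>; then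
    \<open>Y ** C\<close> is the value of \<open>\<psi>\<close> at that inverse.\<close>
  have key: "(B ** (A ** C)) $ a $ b = B $ a $ a * (Y ** C) $ b $ b" for B C
    unfolding matrix_mul_assoc matrix_matrix_mult_def[of "B ** A"] matrix_matrix_mult_def[of Y]
    by (simp add: row sum_distrib_left mult.assoc)
  have "diag_sum G \<theta> \<psi> a b = (\<Sum>g\<in>carrier G. (\<theta> g ** A ** (\<theta> (inv\<^bsub>G\<^esub> g) ** X)) $ a $ b)"
    unfolding diag_sum_def by (intro sum.cong) (simp_all add: \<psi> key flip: matrix_mul_assoc)
  also have "\<dots> = ((\<Sum>g\<in>carrier G. \<theta> g ** A ** \<theta> (inv\<^bsub>G\<^esub> g)) ** X) $ a $ b"
    by (simp add: matrix_mul_sum_right matrix_mul_assoc)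
  also have "\<dots> = of_nat (order G) * trace A / of_nat CARD('n) * X $ a $ b"
    unfolding sum_conj_rep_eq_mat[OF assms(1,2)]
    by (simp add: matrix_matrix_mult_def mat_def if_distrib[where f = "\<lambda>x. x * _"] cong: if_cong)
  also have "trace A = Y $ b $ a"
    by (simp add: trace_def A_def)
  finally show ?thesis
    by simp
qed

section \<open>Intertwiners of unitary representations\<close>

lemma conj_transpose_mult: "conj_transpose (A ** B) = conj_transpose B ** conj_transpose A"
  by (simp add: conj_transpose_def matrix_matrix_mult_def vec_eq_iff mult.commute)

lemma conj_transpose_unitary_rep:
  assumes "group G" "unitary_rep G \<theta>" "g \<in> carrier G"
  shows "conj_transpose (\<theta> g) = \<theta> (inv\<^bsub>G\<^esub> g)"
proof -
  have "conj_transpose (\<theta> g) ** \<theta> g = mat 1" "\<theta> g ** \<theta> (inv\<^bsub>G\<^esub> g) = mat 1"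
    using assms matrix_rep_inv by (auto simp: unitary_rep_def unitary_matrix_def)
  then show ?thesis
    by (metis matrix_mul_assoc matrix_mul_lid matrix_mul_rid)
qed

text \<open>The adjoint of \<open>X\<close> intertwines in the opposite direction, so X X* commutes
  with \<open>\<theta>\<close> and is scalar by Schur's lemma. Its diagonal entries are sums of
  squared moduli along rows of \<open>X\<close>; a row with a nonzero entry shows that the scalar is
  real and positive.\<close>

lemma intertwiner_mult_conj_transpose:
  fixes X :: "complex ^ 'n ^ 'n"
  assumes "group G" "unitary_rep G \<theta>" "irreducible_rep G \<theta>" "unitary_rep G \<psi>"
    and X: "X \<noteq> 0" and tw: "\<And>g. g \<in> carrier G \<Longrightarrow> X ** \<psi> g = \<theta> g ** X"
  obtains c :: real where "c > 0" "X ** conj_transpose X = mat (of_real c)"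
proof -
  interpret group G by fact
  \<comment> \<open>Take adjoints in \<open>tw\<close> at the inverse of g: by unitarity, the
    adjoint of the value at the inverse is the value at g.\<close>
  have tw': "\<psi> g ** conj_transpose X = conj_transpose X ** \<theta> g" if g: "g \<in> carrier G" for g
    using arg_cong[OF tw[of "inv\<^bsub>G\<^esub> g"], of conj_transpose] g
    by (simp add: conj_transpose_mult conj_transpose_unitary_rep[OF assms(1,2)]
        conj_transpose_unitary_rep[OF assms(1,4)])
  have comm: "(X ** conj_transpose X) ** \<theta> g = \<theta> g ** (X ** conj_transpose X)" if "g \<in> carrier G" for g
    using tw[OF that] tw'[OF that] by (metis matrix_mul_assoc)
  obtain z where z: "X ** conj_transpose X = mat z"
    by (rule schur_lemma[OF assms(3) comm])
  have entry: "(X ** conj_transpose X) $ i $ i = of_real (\<Sum>j\<in>UNIV. (cmod (X $ i $ j))\<^sup>2)" for i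
    by (simp add: matrix_matrix_mult_def conj_transpose_def complex_norm_square del: of_real_power)
  obtain i j where ij: "X $ i $ j \<noteq> 0"
    using X by (auto simp: vec_eq_iff)
  define c where "c = (\<Sum>j\<in>UNIV. (cmod (X $ i $ j))\<^sup>2)"
  have "c > 0"
    unfolding c_def using ij by (intro sum_pos2[where i = j]) auto
  moreover have "z = of_real c"
    using entry[of i] by (simp add: z mat_def c_def)
  ultimately show thesis
    using that z by blast
qed

section \<open>From the intertwiner to the doubly stochastic matrix\<close>

theorem mainTheorem3:
  fixes G :: "('g, 'm) monoid_scheme"
    and \<theta> \<psi> :: "'g \<Rightarrow> complex ^ 'n ^ 'n"
  assumes "group G" and "finite (carrier G)"
    and "unitary_rep G \<theta>" and "irreducible_rep G \<theta>"
    and "unitary_rep G \<psi>" and "irreducible_rep G \<psi>"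
    and "\<exists>g\<in>carrier G. \<theta> g \<noteq> \<psi> g"
    and "equivalent_reps G \<theta> \<psi>"
  shows "(\<forall>a b. diag_sum G \<theta> \<psi> a b \<in> \<real> \<and> 0 \<le> Re (diag_sum G \<theta> \<psi> a b)) \<and>
    (\<forall>a. (\<Sum>b\<in>UNIV. (r_coeff G \<theta> \<psi> a b)\<^sup>2) = 1) \<and>
    (\<forall>b. (\<Sum>a\<in>UNIV. (r_coeff G \<theta> \<psi> a b)\<^sup>2) = 1) \<and>
    doubly_stochastic (\<chi> a b. (r_coeff G \<theta> \<psi> a b)\<^sup>2)"
proof -
  interpret group G by fact
  obtain X where "invertible X" and \<psi>: "\<And>g. g \<in> carrier G \<Longrightarrow> \<psi> g = matrix_inv X ** \<theta> g ** X"
    using assms(8) by (auto simp: equivalent_reps_def)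
  define Y where "Y = matrix_inv X"
  \<comment> \<open>\<open>matrix_inv\<close> is a Hilbert choice, so the existence of a two-sided
    inverse yields both equations.\<close>
  have "X ** Y = mat 1 \<and> Y ** X = mat 1"
    unfolding Y_def matrix_inv_def
    by (rule someI_ex) (use \<open>invertible X\<close> in \<open>simp add: invertible_def\<close>)
  then have XY: "X ** Y = mat 1" and YX: "Y ** X = mat 1"
    by simp_all
  have "X \<noteq> 0"
  proof
    assume "X = 0"
    then have "mat 1 = (0 :: complex ^ 'n ^ 'n)"
      using XY by simp
    then show False
      by (simp add: vec_eq_iff mat_def) (metis one_neq_zero)
  qed
  moreover have "X ** \<psi> g = \<theta> g ** X" if "g \<in> carrier G" for g
    using \<psi>[OF that] XY by (simp add: matrix_mul_assoc flip: Y_def)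
  ultimately obtain c where "c > 0" and c: "X ** conj_transpose X = mat (of_real c)"
    using intertwiner_mult_conj_transpose[OF assms(1,3,4,5)] by metis
  \<comment> \<open>Multiply \<open>c\<close> on the left by \<open>Y\<close>.\<close>
  have "conj_transpose X = Y ** mat (of_real c)"
    using c YX by (metis matrix_mul_assoc matrix_mul_lid)
  then have Y: "cnj (X $ a $ b) = Y $ b $ a * of_real c" for a b
    by (simp add: vec_eq_iff conj_transpose_def matrix_matrix_mult_def mat_def
        if_distrib[where f = "\<lambda>x. _ * x"] cong: if_cong)
  \<comment> \<open>This is the product of the (b,a) entry of \<open>Y\<close> and the (a,b) entry
    of \<open>X\<close>, expressed as a manifestly nonnegative real; it turns out to be the squared
    coefficient.\<close>
  define s where "s a b = (cmod (X $ a $ b))\<^sup>2 / c" for a b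
  have s: "Y $ b $ a * X $ a $ b = of_real (s a b)" for a b
  proof -
    have "X $ a $ b * cnj (X $ a $ b) = of_real (s a b * c)"
      using \<open>c > 0\<close> by (simp add: s_def complex_norm_square del: of_real_power)
    then show ?thesis
      using \<open>c > 0\<close> by (simp add: Y mult.commute)
  qed
  have s_nonneg: "0 \<le> s a b" for a b
    using \<open>c > 0\<close> by (simp add: s_def)
  have ord: "order G > 0"
    using assms(2) by (simp add: order_gt_0_iff_finite)
  have d: "diag_sum G \<theta> \<psi> a b = of_real (real (order G) / real CARD('n) * s a b)" for a b
    using diag_sum_conj[OF assms(1,4) \<psi>, of a b] s by (simp flip: Y_def)
  \<comment> \<open>By \<open>d\<close> the sum is real and nonnegative, so taking \<open>Re\<close>
    loses nothing and both square roots are undone by squaring. The factors n/|G| and |G|/n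
    cancel.\<close>
  have r: "(r_coeff G \<theta> \<psi> a b)\<^sup>2 = s a b" for a b
    using ord s_nonneg[of a b] by (simp add: r_coeff_def d power_mult_distrib)
  \<comment> \<open>The sums are evaluated in the complex numbers as diagonal entries, then pulled
    back along the injective embedding of the reals.\<close>
  have "of_real (\<Sum>b\<in>UNIV. s a b) = (X ** Y) $ a $ a" for a
    by (simp add: matrix_matrix_mult_def mult.commute flip: s)
  then have row: "(\<Sum>b\<in>UNIV. s a b) = 1" for a
    by (simp add: XY mat_def del: of_real_sum)
  have "of_real (\<Sum>a\<in>UNIV. s a b) = (Y ** X) $ b $ b" for b
    by (simp add: matrix_matrix_mult_def flip: s)
  then have col: "(\<Sum>a\<in>UNIV. s a b) = 1" for b
    by (simp add: YX mat_def del: of_real_sum)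
  show ?thesis
    using row col s_nonneg by (simp add: r d doubly_stochastic_def)
qed

end
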